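(* Let $q$ be a power of an odd prime $p$ and let $m$ be an integer with $m\mid q+1$ and $2\le m\le\frac{q+1}{3}$, and assume $p\nmid (m-1)$. Let $u\in\mathbb{F}_{q^2}\setminus\mathbb{F}_q$, and let $C'$ be a maximal clique in $\mathrm{GP}(q^2,m)$ such that $N(u)\cup\{u\}\subseteq C'$. Then $$|C'|\le \frac{q+1}{m}-1+\gcd\Big(q-1,\frac{q+1}{m}-2\Big)\le \frac{q+1}{m}+\sqrt{2(q+1)}-3.$$ Moreover, there is $a\in\mathbb{F}_q$ such that $C'$ is contained in the union of the line $\mathbb{F}_q$ and the line $a+(u-a)\mathbb{F}_q$; more precisely, $C'\subseteq N(u)\cup\big(a+(u-a)H\big)$, where $H$ is the unique subgroup of $\mathbb{F}_q^*$ of order $\gcd(q-1,\frac{q+1}{m}-2)$.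
   Context: The generalised Paley graph $\mathrm{GP}(q^2,m)$ has vertex set $\mathbb{F}_{q^2}$, with two distinct vertices $x,y$ adjacent iff $x-y$ is an $m$-th power of an element of $\mathbb{F}_{q^2}^*$. For $u\in\mathbb{F}_{q^2}$, $N(u)=\{x\in\mathbb{F}_q: u-x \text{ is an } m\text{-th power in }\mathbb{F}_{q^2}\}$. Lines are sets $\{a+cs: c\in\mathbb{F}_q\}$ with $a\in\mathbb{F}_{q^2}$, $s\in\mathbb{F}_{q^2}^*$ (viewing $\mathbb{F}_{q^2}$ as a 2-dimensional $\mathbb{F}_q$-vector space). *)

theory Defs
  imports Complex_Main "HOL-Library.Ramsey" "HOL-Computational_Algebra.Primes"
begin

text \<open>
  The field with q^2 elements is a type of class \<open>{field, finite}\<close> with q^2 elements, and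
  its subfield with q elements is a subset \<open>K\<close> of that type.
\<close>

definition is_subfield :: "'a::field set \<Rightarrow> bool" where
  "is_subfield K \<longleftrightarrow> 0 \<in> K \<and> 1 \<in> K \<and>
     (\<forall>x\<in>K. \<forall>y\<in>K. x + y \<in> K \<and> x * y \<in> K) \<and> (\<forall>x\<in>K. - x \<in> K \<and> inverse x \<in> K)"

definition is_mult_subgroup :: "'a::field set \<Rightarrow> 'a set \<Rightarrow> bool" where
  "is_mult_subgroup H K \<longleftrightarrow> H \<subseteq> K - {0} \<and> 1 \<in> H \<and>
     (\<forall>x\<in>H. \<forall>y\<in>H. x * y \<in> H) \<and> (\<forall>x\<in>H. inverse x \<in> H)"

text \<open>
  Edges are unordered pairs. In a field with q^2 elements, q odd and m dividing q + 1, the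
  element -1 is an m-th power, so the order in which \<open>x\<close> and \<open>y\<close> are taken is irrelevant.
\<close>

definition GP_edges :: "nat \<Rightarrow> 'a::field set set" where
  "GP_edges m = {{x, y} | x y. x \<noteq> y \<and> (\<exists>z. z \<noteq> 0 \<and> x - y = z ^ m)}"

text \<open>Maximal with respect to inclusion, not necessarily of maximum size.\<close>

definition maximal_clique :: "'a set \<Rightarrow> 'a set set \<Rightarrow> bool" where
  "maximal_clique C E \<longleftrightarrow> clique C E \<and> (\<forall>D. clique D E \<and> C \<subseteq> D \<longrightarrow> D = C)"

definition GP_nbrs :: "'a::field set \<Rightarrow> nat \<Rightarrow> 'a \<Rightarrow> 'a set" where
  "GP_nbrs K m u = {x \<in> K. \<exists>z. u - x = z ^ m}"

definition line :: "'a::field set \<Rightarrow> 'a \<Rightarrow> 'a \<Rightarrow> 'a set" where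
  "line K a s = {a + c * s | c. c \<in> K}"

end

theory Submission
  imports Defs "HOL-Number_Theory.Residues" "HOL-Computational_Algebra.Polynomial"
begin

text \<open>
  Let \<open>k = (q + 1) / m\<close>. An element \<open>x\<close> of \<open>Fq\<close> lies in \<open>N(u)\<close> iff \<open>(u - x) ^ ((q - 1) k) = 1\<close>, that is,
  iff \<open>x\<close> is a root of \<open>(X - u)\<^sup>k - (X - u\<^sup>q)\<^sup>k\<close>, a polynomial of degree \<open>k - 1\<close>; since \<open>N(u)\<close> has
  \<open>k - 1\<close> elements, it determines this polynomial up to a factor. A vertex \<open>v\<close> of the clique outside
  \<open>Fq\<close> has the same neighbours in \<open>Fq\<close> as \<open>u\<close>, so comparing polynomials shows that \<open>u\<close> and \<open>v\<close> have the
  same trace \<open>2a\<close> over \<open>Fq\<close> and that \<open>v = a + c (u - a)\<close> with \<open>c ^ (k - 2) = 1\<close>.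
\<close>

section \<open>Roots of unity in finite multiplicatively closed subsets of a field\<close>

lemma power_card_eq_1:
  fixes G :: "'a::field set"
  assumes "finite G" "0 \<notin> G" "\<And>x y. x \<in> G \<Longrightarrow> y \<in> G \<Longrightarrow> x * y \<in> G" "x \<in> G"
  shows "x ^ card G = 1"
proof -
  have "x \<noteq> 0" using assms by auto
  then have inj: "inj_on ((*) x) G" by (auto intro: inj_onI)
  \<comment> \<open>An injective self-map of a finite set is a permutation, so multiplying every
    factor by \<open>x\<close> leaves the product over \<open>G\<close> unchanged.\<close>
  then have img: "(*) x ` G = G" using assms by (intro endo_inj_surj) auto
  have "\<Prod>G = (\<Prod>y\<in>G. x * y)"
    using prod.reindex[OF inj, of "\<lambda>y. y"] img by simp
  also have "\<dots> = x ^ card G * \<Prod>G" by (simp add: prod.distrib)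
  finally show ?thesis using assms by (auto simp: prod_zero_iff)
qed

lemma
  fixes c :: "'a::field"
  assumes "n > 0"
  shows finite_nth_roots_field: "finite {x. x ^ n = c}"
    and card_nth_roots_field_le: "card {x. x ^ n = c} \<le> n"
proof -
  let ?p = "monom 1 n + [:- c:]"
  have deg: "degree ?p = n"
    using assms degree_add_eq_left[of "[:- c:]" "monom 1 n"] by (simp add: degree_monom_eq)
  then have "?p \<noteq> 0" using assms by (metis degree_0 less_irrefl)
  moreover have "{x. poly ?p x = 0} = {x. x ^ n = c}" by (auto simp: poly_monom)
  ultimately show "finite {x. x ^ n = c}" "card {x. x ^ n = c} \<le> n"
    using poly_roots_finite[of ?p] card_poly_roots_bound[of ?p] deg by auto
qed

text \<open>Every element of \<open>G\<close> is a root of X^(d e) - 1 = (X^d - 1) (1 + X^d + ... +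
  X^(d (e - 1))). The second factor has at most d (e - 1) roots, so at least \<open>d\<close>
  elements are left for the first.\<close>

lemma card_roots_of_unity:
  fixes G :: "'a::field set"
  assumes "finite G" "0 \<notin> G" "\<And>x y. x \<in> G \<Longrightarrow> y \<in> G \<Longrightarrow> x * y \<in> G"
    and "card G = d * e" "d > 0" "e > 0"
  shows "card {x \<in> G. x ^ d = 1} = d"
proof (rule antisym)
  show "card {x \<in> G. x ^ d = 1} \<le> d"
    using card_nth_roots_field_le[OF \<open>d > 0\<close>, of "1::'a"]
    by (rule order_trans[OF card_mono[OF finite_nth_roots_field[OF \<open>d > 0\<close>]], rotated]) auto
  let ?p = "\<Sum>i<e. monom 1 (d * i) :: 'a poly"
  have deg: "degree ?p \<le> d * (e - 1)"
    using assms by (intro degree_sum_le) (auto simp: degree_monom_eq)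
  have "coeff ?p 0 = (\<Sum>i<e. if i = 0 then 1 else 0)"
    using assms by (auto simp: coeff_sum intro!: sum.cong)
  then have "coeff ?p 0 = 1" using \<open>e > 0\<close> by simp
  then have nz: "?p \<noteq> 0" by (metis coeff_0 zero_neq_one)
  have "poly ?p x = 0" if "x \<in> G" "x ^ d \<noteq> 1" for x
  proof -
    have "(x ^ d) ^ e - 1 = (x ^ d - 1) * (\<Sum>i<e. (x ^ d) ^ i)"
      by (rule power_diff_1_eq)
    moreover have "(x ^ d) ^ e = 1"
      using power_card_eq_1[OF assms(1-3) that(1)] assms(4) by (simp add: power_mult)
    ultimately show ?thesis using that(2) by (simp add: poly_sum poly_monom power_mult)
  qed
  then have "G \<subseteq> {x \<in> G. x ^ d = 1} \<union> {x. poly ?p x = 0}" by auto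
  then have "card G \<le> card ({x \<in> G. x ^ d = 1} \<union> {x. poly ?p x = 0})"
    using assms(1) poly_roots_finite[OF nz] by (intro card_mono) auto
  also have "\<dots> \<le> card {x \<in> G. x ^ d = 1} + card {x. poly ?p x = 0}" by (rule card_Un_le)
  finally have "d * e \<le> card {x \<in> G. x ^ d = 1} + d * (e - 1)"
    using card_poly_roots_bound[OF nz] deg assms(4) by linarith
  then show "d \<le> card {x \<in> G. x ^ d = 1}"
    using \<open>e > 0\<close> by (cases e) auto
qed

text \<open>The fibres of the \<open>m\<close>-th power map have at most \<open>m\<close> elements,
  so its image has at least \<open>e\<close>. The image consists of \<open>e\<close>-th roots of
  unity, of which \<open>G\<close> has exactly \<open>e\<close>, so the two sets coincide.\<close>

lemma ex_root_iff_power_eq_1: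
  fixes y :: "'a::field"
  assumes "finite G" "0 \<notin> G" "1 \<in> G" "\<And>x y. x \<in> G \<Longrightarrow> y \<in> G \<Longrightarrow> x * y \<in> G"
    and "card G = m * e" "m > 0" "e > 0" "y \<in> G"
  shows "(\<exists>z\<in>G. y = z ^ m) \<longleftrightarrow> y ^ e = 1"
proof -
  have pow: "z ^ i \<in> G" if "z \<in> G" for z i
    using that by (induction i) (auto intro: assms)
  let ?I = "(\<lambda>z. z ^ m) ` G" and ?R = "{y \<in> G. y ^ e = 1}"
  have sub: "?I \<subseteq> ?R"
    using power_card_eq_1[OF assms(1,2,4)] assms(5) pow by (auto simp: power_mult)
  have "m * e \<le> card (\<Union>y\<in>?I. {z. z ^ m = y})"
    unfolding assms(5)[symmetric] using assms finite_nth_roots_field by (intro card_mono) auto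
  also have "\<dots> \<le> (\<Sum>y\<in>?I. card {z. z ^ m = y})"
    using assms by (intro card_UN_le) auto
  also have "\<dots> \<le> (\<Sum>y\<in>?I. m)" using card_nth_roots_field_le assms by (intro sum_mono) auto
  finally have "e \<le> card ?I" using \<open>m > 0\<close> by simp
  moreover have "card ?R = e"
    using card_roots_of_unity[OF assms(1,2,4), of e m] assms by (simp add: mult.commute)
  ultimately have "?I = ?R" using sub assms(1) by (intro card_seteq) auto
  then show ?thesis using \<open>y \<in> G\<close> by auto
qed

text \<open>By Lagrange, a subgroup of order \<open>d\<close> lies in the set of \<open>d\<close>-th
  roots of unity in \<open>K\<close>, which itself has only \<open>d\<close> elements. This gives
  existence and uniqueness of the subgroup at once.\<close>

lemma mult_subgroup_card_iff:
  fixes K :: "'a::field set"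
  assumes K: "is_subfield K" "finite K" and d: "d dvd card K - 1" "card K > 1"
  shows "is_mult_subgroup H K \<and> card H = d \<longleftrightarrow> H = {x \<in> K. x ^ d = 1}"
proof -
  obtain e where e: "card K - 1 = d * e" using d by blast
  have pos: "d > 0" "e > 0" using e d by (auto intro: Nat.gr0I)
  let ?R = "{x \<in> K. x ^ d = 1}"
  have "{x \<in> K - {0}. x ^ d = 1} = ?R" using pos by (auto simp: power_0_left)
  moreover have "card {x \<in> K - {0}. x ^ d = 1} = d"
    using K d e pos by (intro card_roots_of_unity[where e = e]) (auto simp: is_subfield_def)
  ultimately have cR: "card ?R = d" by simp
  have "is_mult_subgroup ?R K"
    using K pos
    by (auto simp: is_mult_subgroup_def is_subfield_def power_mult_distrib power_inverse power_0_left)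
  moreover have "H = ?R" if H: "is_mult_subgroup H K" "card H = d"
  proof (rule card_seteq)
    have "finite H" using H pos card.infinite by fastforce
    then show "H \<subseteq> ?R"
      using power_card_eq_1[of H] H by (auto simp: is_mult_subgroup_def)
  qed (use H cR K in auto)
  ultimately show ?thesis using cR by auto
qed

lemma power_gcd_eq_1:
  fixes x :: "'a::monoid_mult"
  assumes "x ^ a = 1" "x ^ b = 1"
  shows "x ^ gcd a b = 1"
proof (cases "a = 0")
  case False
  then obtain i j where "a * i = b * j + gcd a b" using bezout_nat by blast
  then have "x ^ (a * i) = x ^ (b * j) * x ^ gcd a b" by (simp add: power_add)
  then show ?thesis using assms by (simp add: power_mult)
qed (use assms in simp)

section \<open>Comparison of two polynomials with common roots\<close>

text \<open>
  The polynomials \<open>(X - u)\<^sup>k - (X - u')\<^sup>k\<close> and \<open>(X - v)\<^sup>k - (X - v')\<^sup>k\<close> have degree \<open>k - 1\<close>, so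
  sharing \<open>k - 1\<close> roots makes them proportional. Their coefficients at \<open>k - 2\<close> then give the first
  claim, and their derivatives at the common midpoint of \<open>u, u'\<close> and \<open>v, v'\<close> the second.
\<close>

lemma common_roots_power_diff:
  fixes u u' v v' :: "'a::field"
  assumes k: "k \<ge> 2" "of_nat k \<noteq> (0::'a)" "of_nat (k - 1) \<noteq> (0::'a)" "(2::'a) \<noteq> 0"
    and ne: "u \<noteq> u'" "v \<noteq> v'"
    and A: "card A \<ge> k - 1"
    and uA: "\<And>x. x \<in> A \<Longrightarrow> (x - u) ^ k = (x - u') ^ k"
    and vA: "\<And>x. x \<in> A \<Longrightarrow> (x - v) ^ k = (x - v') ^ k"
  shows "u + u' = v + v'"
    and "even k \<Longrightarrow> ((v - v') / (u - u')) ^ (k - 2) = 1"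
proof -
  define f where "f = (\<lambda>a b. [:- a, 1:] ^ k - [:- b, 1:] ^ k :: 'a poly)"
  have coeff_f: "coeff (f a b) i = of_nat (k choose i) * ((- a) ^ (k - i) - (- b) ^ (k - i))"
    if "i \<le> k" for a b i
    using that by (simp add: f_def coeff_linear_poly_power algebra_simps)
  have deg: "degree (f a b) \<le> k - 1" for a b
  proof (rule degree_le, intro allI impI)
    fix i assume "i > k - 1"
    then consider "i = k" | "i > k" by linarith
    then show "coeff (f a b) i = 0"
    proof cases
      case 2
      have "degree (f a b) \<le> k"
        unfolding f_def by (intro degree_diff_le) (auto simp: degree_linear_power)
      then show ?thesis using 2 by (intro coeff_eq_0) simp
    qed (simp add: coeff_f)
  qed
  \<comment> \<open>The scalars make the coefficients at \<open>k - 1\<close> equal, so the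
    difference has degree below \<open>k - 1\<close> and agreement on \<open>A\<close>
    suffices.\<close>
  have eq: "smult (v - v') (f u u') = smult (u - u') (f v v')"
  proof (rule poly_eqI_degree_lead_coeff[where n = "k - 1" and A = A])
    show "coeff (smult (v - v') (f u u')) (k - 1) = coeff (smult (u - u') (f v v')) (k - 1)"
      using k by (simp add: coeff_f algebra_simps)
    show "poly (smult (v - v') (f u u')) z = poly (smult (u - u') (f v v')) z" if "z \<in> A" for z
      using uA[OF that] vA[OF that] by (simp add: f_def poly_power)
  qed (use A deg degree_smult_le order_trans in blast)+
  \<comment> \<open>In the field, twice the binomial coefficient is a product of the nonzero
    elements \<open>k\<close> and \<open>k - 1\<close>, so it can be cancelled.\<close>
  have "2 * (k choose (k - 2)) = k * (k - 1)"
    using k binomial_symmetric[of "k - 2" k] by (simp add: choose_two)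
  then have "2 * of_nat (k choose (k - 2)) = (of_nat k * of_nat (k - 1) :: 'a)"
    by (metis of_nat_mult of_nat_numeral)
  then have bin: "of_nat (k choose (k - 2)) \<noteq> (0::'a)" using k by auto
  have "of_nat (k choose (k - 2)) * ((v - v') * (u\<^sup>2 - u'\<^sup>2))
      = of_nat (k choose (k - 2)) * ((u - u') * (v\<^sup>2 - v'\<^sup>2))"
    using arg_cong[OF eq, of "\<lambda>p. coeff p (k - 2)"] k by (simp add: coeff_f mult_ac)
  then have "(v - v') * (u\<^sup>2 - u'\<^sup>2) = (u - u') * (v\<^sup>2 - v'\<^sup>2)" using bin by simp
  then have "(u - u') * (v - v') * ((u + u') - (v + v')) = 0"
    by (simp add: algebra_simps power2_eq_square)
  then show sum: "u + u' = v + v'" using ne by simp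
  assume "even k"
  define w s where "w = (u - u') / 2" and "s = (v - v') / 2"
  have odd: "odd (k - 1)" using \<open>even k\<close> k by auto
  \<comment> \<open>Seen from the midpoint, \<open>u\<close> and \<open>u'\<close> are opposite, and
    so are \<open>v\<close> and \<open>v'\<close>. As \<open>k - 1\<close> is odd, the two powers in
    each derivative add up instead of cancelling.\<close>
  let ?a = "(u + u') / 2"
  have v': "v' = u + u' - v" using sum by simp
  have arg: "?a - u = - w" "?a - u' = w" "?a - v = - s" "?a - v' = s"
    unfolding w_def s_def v' using k(4) by (simp_all add: field_simps)
  have der: "poly (pderiv (f a b)) x = of_nat k * ((x - a) ^ (k - 1) - (x - b) ^ (k - 1))" for a b x
    using k by (simp add: f_def pderiv_diff pderiv_power pderiv_pCons algebra_simps poly_power)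
  have "(v - v') * (of_nat k * ((- w) ^ (k - 1) - w ^ (k - 1)))
      = (u - u') * (of_nat k * ((- s) ^ (k - 1) - s ^ (k - 1)))"
    using arg_cong[OF eq, of "\<lambda>p. poly (pderiv p) ?a"] unfolding pderiv_smult poly_smult der arg .
  moreover have vs: "v - v' = 2 * s" "u - u' = 2 * w" using k by (simp_all add: w_def s_def)
  ultimately have "(-4 * of_nat k) * (s * w ^ (k - 1)) = (-4 * of_nat k) * (w * s ^ (k - 1))"
    using odd by (auto simp: algebra_simps)
  moreover have "(-4 :: 'a) * of_nat k \<noteq> 0"
    using k by (metis mult_2 mult_eq_0_iff neg_equal_0_iff_equal numeral_Bit0 mult_numeral_left_semiring_numeral add.left_neutral)
  ultimately have "s * w ^ (k - 1) = w * s ^ (k - 1)" by simp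
  moreover have "k - 1 = Suc (k - 2)" using k by simp
  ultimately have "(w * s) * w ^ (k - 2) = (w * s) * s ^ (k - 2)" by (simp add: mult_ac)
  moreover have ws: "w \<noteq> 0" "s \<noteq> 0" using ne k by (auto simp: w_def s_def)
  ultimately have "w ^ (k - 2) = s ^ (k - 2)" by simp
  then show "((v - v') / (u - u')) ^ (k - 2) = 1"
    using ws k unfolding vs by (simp add: power_divide)
qed

text \<open>The gcd is at most \<open>k - 2\<close>, and it divides (q - 1) - m (k - 2) = 2 (m - 1).
  Adding 2 to both bounds and multiplying them gives 2 m k.\<close>

lemma gcd_quotient_bound:
  fixes q m k :: nat
  assumes "m * k = q + 1" "m \<ge> 2" "k \<ge> 3"
  shows "(gcd (q - 1) (k - 2) + 2)\<^sup>2 \<le> 2 * (q + 1)"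
proof -
  let ?d = "gcd (q - 1) (k - 2)"
  have "?d \<le> k - 2" using assms by (intro gcd_le2_nat) auto
  then have "?d + 2 \<le> k" using assms(3) by linarith
  moreover have "?d \<le> 2 * (m - 1)"
  proof (rule dvd_imp_le)
    have "?d dvd m * (k - 2)" "?d dvd q - 1" by (blast intro: gcd_dvd1 gcd_dvd2 dvd_mult)+
    then have "?d dvd (q - 1) - m * (k - 2)" by (rule dvd_diff_nat[rotated])
    moreover have "m * 3 \<le> m * k" using assms by (intro mult_le_mono) auto
    then have "(q - 1) - m * (k - 2) = 2 * (m - 1)"
      using assms(1,2) unfolding diff_mult_distrib2 by linarith
    ultimately show "?d dvd 2 * (m - 1)" by simp
  qed (use assms in simp)
  ultimately have "(?d + 2) * (?d + 2) \<le> (2 * m) * k"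
    using assms by (intro mult_le_mono) auto
  then show ?thesis using assms by (simp add: power2_eq_square)
qed

section \<open>The subfield and its translates\<close>

lemma subfield_eq_fixed_points:
  fixes K :: "'a::field set"
  assumes "is_subfield K" "card K = q" "q > 1"
  shows "x \<in> K \<longleftrightarrow> x ^ q = x"
proof -
  have fin: "finite K" using assms card.infinite by fastforce
  have c: "card (K - {0}) = q - 1" using assms fin by (simp add: is_subfield_def)
  have sub: "K - {0} \<subseteq> {x. x ^ (q - 1) = 1}"
    using power_card_eq_1[of "K - {0}"] assms fin c by (auto simp: is_subfield_def)
  \<comment> \<open>The left side already has \<open>q - 1\<close> elements, the maximal number of
    roots.\<close>
  have "K - {0} = {x. x ^ (q - 1) = 1}"
    using card_nth_roots_field_le[of "q - 1" "1::'a"] assms c sub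
    by (intro card_seteq finite_nth_roots_field) auto
  moreover have "x ^ q = x * x ^ (q - 1)" using assms by (cases q) auto
  ultimately show ?thesis using assms by (cases "x = 0") (auto simp: is_subfield_def)
qed

text \<open>
  Every element outside \<open>K\<close> is uniquely \<open>c (u - x)\<close> with \<open>c \<noteq> 0\<close> and \<open>x\<close> in \<open>K\<close>, and the factor
  \<open>c\<close> does not affect membership in the group of \<open>(q - 1) k\<close>-th roots of unity.
\<close>

lemma card_power_translates:
  fixes K :: "'a::{field,finite} set"
  assumes K: "is_subfield K" "card K = q" "q > 1" and card: "card (UNIV :: 'a set) = q\<^sup>2"
    and u: "u \<notin> K" and k: "k dvd q + 1"
  shows "card {x \<in> K. (u - x) ^ ((q - 1) * k) = 1} = k - 1"
proof -
  obtain m where m: "q + 1 = k * m" using k by blast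
  have pos: "k > 0" "m > 0" using m by (auto intro: Nat.gr0I)
  let ?g = "\<lambda>(c, x). c * (u - x)"
  let ?M = "(q - 1) * k"
  let ?P = "{y :: 'a. y ^ ?M = 1}" and ?N = "{x \<in> K. (u - x) ^ ?M = 1}"
  have Kcl: "x + y \<in> K" "x * y \<in> K" "- x \<in> K" "inverse x \<in> K" "0 \<in> K" if "x \<in> K" "y \<in> K" for x y
    using K that by (auto simp: is_subfield_def)
  have Kdiff: "x - y \<in> K" if "x \<in> K" "y \<in> K" for x y
    using Kcl(1)[of x "- y"] Kcl(3)[of y y] that by simp
  have Kdiv: "x / y \<in> K" if "x \<in> K" "y \<in> K" for x y
    using Kcl(2)[of x "inverse y"] Kcl(4)[of y y] that by (simp add: divide_inverse)
  have cK: "card (K - {0}) = q - 1" using K by (simp add: is_subfield_def)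
  have K1: "c ^ (q - 1) = 1" if "c \<in> K" "c \<noteq> 0" for c
    using power_card_eq_1[of "K - {0}" c] that cK Kcl by auto
  have unique: "c = d \<and> x = y"
    if *: "c \<in> K" "c \<noteq> 0" "x \<in> K" "d \<in> K" "d \<noteq> 0" "y \<in> K" "c * (u - x) = d * (u - y)"
    for c x d y
  proof -
    have "c = d"
    proof (rule ccontr)
      assume "c \<noteq> d"
      then have "u = (c * x - d * y) / (c - d)" using * by (simp add: field_simps)
      moreover have "(c * x - d * y) / (c - d) \<in> K"
        by (intro Kdiv Kdiff Kcl(2)) (use * in auto)
      ultimately show False using u by simp
    qed
    then show ?thesis using * by auto
  qed
  have inj: "inj_on ?g ((K - {0}) \<times> K)"
  proof (rule inj_onI)
    fix s t assume "s \<in> (K - {0}) \<times> K" "t \<in> (K - {0}) \<times> K" "?g s = ?g t"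
    then show "s = t" using unique[of "fst s" "snd s" "fst t" "snd t"] by (cases s; cases t) auto
  qed
  have "c * (u - x) \<notin> K" if "c \<in> K" "c \<noteq> 0" "x \<in> K" for c x
  proof
    assume "c * (u - x) \<in> K"
    then have "c * (u - x) / c + x \<in> K" using that by (intro Kcl(1) Kdiv)
    then show False using that u by simp
  qed
  then have sub: "?g ` ((K - {0}) \<times> K) \<subseteq> UNIV - K" by auto
  have cU: "card (UNIV - K) = q * (q - 1)"
    using card K by (simp add: card_Diff_subset power2_eq_square diff_mult_distrib2)
  have surj: "?g ` ((K - {0}) \<times> K) = UNIV - K"
    using sub cU cK K by (intro card_seteq) (auto simp: card_image[OF inj] card_cartesian_product)
  have gP: "c * (u - x) \<in> ?P \<longleftrightarrow> (u - x) \<in> ?P" if "c \<in> K" "c \<noteq> 0" for c x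
    using K1[OF that] by (simp add: power_mult_distrib power_mult)
  have "?P - K = ?g ` ((K - {0}) \<times> ?N)"
  proof (intro equalityI subsetI)
    fix y assume y: "y \<in> ?P - K"
    then have "y \<in> ?g ` ((K - {0}) \<times> K)" using surj by auto
    then obtain c x where "c \<in> K" "c \<noteq> 0" "x \<in> K" "y = c * (u - x)" by auto
    then show "y \<in> ?g ` ((K - {0}) \<times> ?N)" using gP[of c x] y
      by (intro image_eqI[of _ _ "(c, x)"]) auto
  next
    fix y assume "y \<in> ?g ` ((K - {0}) \<times> ?N)"
    then obtain c x where "c \<in> K" "c \<noteq> 0" "x \<in> ?N" "y = c * (u - x)" by auto
    then show "y \<in> ?P - K" using gP[of c x] sub by force
  qed
  moreover have "inj_on ?g ((K - {0}) \<times> ?N)" using inj by (rule inj_on_subset) auto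
  \<comment> \<open>The second count of \<open>?P - K\<close> uses that \<open>?P\<close> has
    \<open>?M\<close> elements and contains the \<open>q - 1\<close> units of
    \<open>K\<close>.\<close>
  ultimately have "card (?P - K) = (q - 1) * card ?N"
    by (simp add: card_image card_cartesian_product cK)
  moreover have "card (?P - K) = card ?P - (q - 1)"
  proof -
    have "?P - K = ?P - (K - {0})" using pos K by (auto simp: power_0_left)
    moreover have "K - {0} \<subseteq> ?P" using K1 by (auto simp: power_mult)
    ultimately show ?thesis using cK by (simp add: card_Diff_subset)
  qed
  moreover have "card ?P = ?M"
  proof -
    have "card (UNIV - {0 :: 'a}) = q\<^sup>2 - 1" by (simp add: card)
    also have "\<dots> = (q - 1) * (q + 1)" using K by (simp add: power2_eq_square algebra_simps)
    also have "\<dots> = ?M * m" unfolding m by (rule mult.assoc[symmetric])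
    finally have "card (UNIV - {0 :: 'a}) = ?M * m" .
    then have "card {x \<in> UNIV - {0 :: 'a}. x ^ ?M = 1} = ?M"
      using pos K by (intro card_roots_of_unity[where e = m]) auto
    moreover have "{x \<in> UNIV - {0 :: 'a}. x ^ ?M = 1} = ?P" using pos K by (auto simp: power_0_left)
    ultimately show ?thesis by simp
  qed
  ultimately have "(q - 1) * card ?N = (q - 1) * (k - 1)" by (simp add: diff_mult_distrib2)
  then show ?thesis using K by simp
qed

theorem theorem5p3:
  fixes p n q m :: nat and Fq :: "'a::{field, finite} set" and u :: 'a and C' :: "'a set"
  assumes "prime p" and "odd p" and "n \<ge> 1" and "q = p ^ n"
    and "card (UNIV :: 'a set) = q\<^sup>2"
    and "is_subfield Fq" and "card Fq = q"
    and "m dvd q + 1" and "2 \<le> m" and "real m \<le> (real q + 1) / 3"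
    and "\<not> p dvd (m - 1)"
    and "u \<notin> Fq"
    and "maximal_clique C' (GP_edges m)"
    and "GP_nbrs Fq m u \<union> {u} \<subseteq> C'"
  shows "real (card C') \<le> (real q + 1) / real m - 1 + real (gcd (q - 1) ((q + 1) div m - 2)) \<and>
    (real q + 1) / real m - 1 + real (gcd (q - 1) ((q + 1) div m - 2))
      \<le> (real q + 1) / real m + sqrt (2 * (real q + 1)) - 3 \<and>
    (\<exists>!H. is_mult_subgroup H Fq \<and> card H = gcd (q - 1) ((q + 1) div m - 2)) \<and>
    (\<exists>a\<in>Fq. C' \<subseteq> Fq \<union> line Fq a (u - a) \<and>
      (\<forall>H. is_mult_subgroup H Fq \<and> card H = gcd (q - 1) ((q + 1) div m - 2) \<longrightarrow>
        C' \<subseteq> GP_nbrs Fq m u \<union> {a + (u - a) * h | h. h \<in> H}))"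
proof -
  define k where "k = (q + 1) div m"
  define M where "M = (q - 1) * k"
  define d where "d = gcd (q - 1) (k - 2)"
  define H where "H = {x \<in> Fq. x ^ d = 1}"
  \<comment> \<open>Half the trace of \<open>u\<close> over \<open>Fq\<close>: with this choice the
    \<open>q\<close>-th power map negates \<open>u - a\<close>.\<close>
  define a where "a = (u + u ^ q) / 2"
  define B where "B = {a + (u - a) * h | h. h \<in> H}"

  \<comment> \<open>Size and characteristic conditions on \<open>q\<close>, \<open>m\<close> and
    \<open>k\<close>\<close>
  have mk: "m * k = q + 1" using assms(8) by (simp add: k_def)
  have "real (3 * m) \<le> real (m * k)" using assms(10) unfolding mk by simp
  then have "3 * m \<le> m * k" by (simp only: of_nat_le_iff)
  then have k3: "k \<ge> 3" using assms(9) by simp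
  have "q \<noteq> 1" using \<open>prime p\<close> \<open>n \<ge> 1\<close> \<open>q = p ^ n\<close> by (auto dest: prime_gt_1_nat)
  moreover have "odd q" using \<open>odd p\<close> \<open>q = p ^ n\<close> by simp
  ultimately have q3: "q \<ge> 3" by (cases "q = 0"; cases "q = 2") auto
  have K: "is_subfield Fq" "card Fq = q" "q > 1" using assms q3 by auto
  note fixed = subfield_eq_fixed_points[OF K]

  have charp: "CHAR('a) = p"
  proof -
    have "prime CHAR('a)"
      using finite_imp_CHAR_pos[where ?'a = 'a] by (intro prime_CHAR_semidom) auto
    moreover have "CHAR('a) dvd p ^ (n * 2)"
      using CHAR_dvd_CARD[where ?'a = 'a] assms by (simp add: power_mult)
    ultimately show ?thesis
      using \<open>prime p\<close> by (metis prime_dvd_power primes_dvd_imp_eq)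
  qed
  have q0: "of_nat q = (0 :: 'a)"
    using assms(3,4) charp by (simp add: of_nat_eq_0_iff_char_dvd)
  have "\<not> p dvd 2" using \<open>prime p\<close> \<open>odd p\<close> primes_dvd_imp_eq two_is_prime_nat by blast
  then have two: "(2 :: 'a) \<noteq> 0"
    using charp of_nat_eq_0_iff_char_dvd[where ?'a = 'a, of 2] by simp
  \<comment> \<open>Since \<open>q\<close> vanishes in the field, \<open>m\<close> and
    \<open>k\<close> are mutually inverse there. So \<open>k = 1\<close> in the field would force
    \<open>m = 1\<close>, against the assumption on \<open>m - 1\<close>.\<close>
  have mk1: "of_nat m * of_nat k = (1 :: 'a)"
    using arg_cong[OF mk, of "of_nat :: nat \<Rightarrow> 'a"] q0 by simp
  then have k0: "of_nat k \<noteq> (0 :: 'a)" by auto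
  have "of_nat (m - 1) \<noteq> (0 :: 'a)"
    using charp assms(11) by (metis of_nat_eq_0_iff_char_dvd)
  moreover have "of_nat (m - 1) = (of_nat m - 1 :: 'a)" "of_nat (k - 1) = (of_nat k - 1 :: 'a)"
    using assms(9) k3 by (simp_all add: of_nat_diff)
  ultimately have k1: "of_nat (k - 1) \<noteq> (0 :: 'a)" using mk1 by auto

  \<comment> \<open>The \<open>q\<close>-th power map, and adjacency as a power condition\<close>
  have add: "(x + y) ^ q = x ^ q + y ^ q" for x y :: 'a
    using charp \<open>prime p\<close> \<open>q = p ^ n\<close> by (intro freshmans_dream') auto
  have diff: "(x - y) ^ q = x ^ q - y ^ q" for x y :: 'a
    using add[of "x - y" y] by simp
  have two_q: "2 ^ q = (2 :: 'a)" using add[of 1 1] by simp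
  have unit: "x ^ ((q - 1) * (q + 1)) = 1" if "x \<noteq> 0" for x :: 'a
  proof -
    have "card (UNIV - {0 :: 'a}) = (q - 1) * (q + 1)"
      using assms(5) q3 by (simp add: power2_eq_square algebra_simps)
    then show ?thesis using power_card_eq_1[of "UNIV - {0 :: 'a}" x] that by auto
  qed
  have qq: "(x ^ q) ^ q = x" for x :: 'a
  proof (cases "x = 0")
    case False
    have "q * q = Suc ((q - 1) * (q + 1))" using q3 by (simp add: algebra_simps)
    then show ?thesis using unit[OF False] by (simp flip: power_mult)
  qed (use q3 in simp)

  have mth_power: "(\<exists>z. z \<noteq> 0 \<and> y = z ^ m) \<longleftrightarrow> y ^ M = 1" if "y \<noteq> 0" for y :: 'a
  proof -
    have "card (UNIV - {0 :: 'a}) = q\<^sup>2 - 1" using assms(5) by simp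
    also have "\<dots> = (q - 1) * (m * k)"
      using q3 unfolding mk by (simp add: power2_eq_square algebra_simps)
    finally have "card (UNIV - {0 :: 'a}) = m * M" by (simp add: M_def mult_ac)
    then show ?thesis
      using ex_root_iff_power_eq_1[of "UNIV - {0 :: 'a}" m M y] that assms(9) k3 q3
      by (auto simp: M_def)
  qed
  have "even (q - 1)" using \<open>odd q\<close> by simp
  then have M_even: "even M" by (simp add: M_def)
  then have minus: "(x - y) ^ M = (y - x) ^ M" for x y :: 'a
    by (metis minus_diff_eq power_minus_even)
  have adj: "(x - y) ^ M = 1" if "x \<in> C'" "y \<in> C'" "x \<noteq> y" for x y
  proof -
    have "{x, y} \<in> GP_edges m"
      using assms(13) that by (auto simp: maximal_clique_def clique_def)
    then obtain x' y' z where "{x, y} = {x', y'}" "x' \<noteq> y'" "z \<noteq> 0" "x' - y' = z ^ m"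
      by (auto simp: GP_edges_def)
    then show ?thesis
      using mth_power[of "x' - y'"] minus by (auto simp: doubleton_eq_iff)
  qed
  have N_eq: "GP_nbrs Fq m u = {x \<in> Fq. (u - x) ^ M = 1}"
  proof -
    have "(\<exists>z. u - x = z ^ m) \<longleftrightarrow> (u - x) ^ M = 1" if "x \<in> Fq" for x
    proof -
      \<comment> \<open>\<open>GP_nbrs\<close> admits \<open>z = 0\<close> while adjacency does not;
        the two agree because \<open>u\<close> is outside \<open>Fq\<close>.\<close>
      have "u - x \<noteq> 0" using that assms(12) by auto
      moreover from this have "z \<noteq> 0" if "u - x = z ^ m" for z using that assms(9) by auto
      ultimately show ?thesis using mth_power[of "u - x"] by blast
    qed
    then show ?thesis by (auto simp: GP_nbrs_def)
  qed
  have cN: "card (GP_nbrs Fq m u) = k - 1"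
    unfolding N_eq M_def using card_power_translates[OF K assms(5,12)] mk
    by (metis dvd_triv_right)

  \<comment> \<open>The \<open>q\<close>-th power map fixes \<open>x\<close>, so it sends
    \<open>x - v\<close> to \<open>x - v ^ q\<close>; the factor separating the two
    \<open>k\<close>-th powers is an \<open>M\<close>-th power equal to 1.\<close>
  have conj_eq: "(x - v) ^ k = (x - v ^ q) ^ k" if "x \<in> Fq" "(v - x) ^ M = 1" for x v
  proof -
    have "(x - v) ^ ((q - 1) * k) = 1" using that(2) minus by (simp add: M_def)
    moreover have "(x - v) ^ (q * k) = (x - v) ^ ((q - 1) * k) * (x - v) ^ k"
      using q3 by (simp add: diff_mult_distrib flip: power_add)
    ultimately have "((x - v) ^ q) ^ k = (x - v) ^ k" by (simp add: power_mult)
    then show ?thesis using that(1) fixed by (simp add: diff)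
  qed
  have uq: "u \<noteq> u ^ q" using assms(12) fixed by metis
  have a_Fq: "a \<in> Fq" unfolding fixed a_def by (simp add: power_divide add two_q qq add.commute)
  have ua: "u - a = (u - u ^ q) / 2" using two by (simp add: a_def field_simps)

  \<comment> \<open>Clique vertices outside \<open>Fq\<close>\<close>
  have main: "v \<in> B" if v: "v \<in> C'" "v \<notin> Fq" for v
  proof -
    have vq: "v \<noteq> v ^ q" using v fixed by metis
    have nbr: "(v - x) ^ M = 1" if "x \<in> GP_nbrs Fq m u" for x
      using adj[OF v(1), of x] that assms(14) v(2) by (auto simp: GP_nbrs_def)
    let ?A = "GP_nbrs Fq m u"
    have roots: "(x - u) ^ k = (x - u ^ q) ^ k" "(x - v) ^ k = (x - v ^ q) ^ k" if "x \<in> ?A" for x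
      using conj_eq[of x u] conj_eq[of x v] nbr that N_eq by auto
    have k2: "k \<ge> 2" using k3 by simp
    note common = common_roots_power_diff[OF k2 k0 k1 two uq vq eq_imp_le[OF cN[symmetric]] roots]
    \<comment> \<open>Numerator and denominator both change sign under the \<open>q\<close>-th power
      map, so \<open>c\<close> is in \<open>Fq\<close>. By equality of traces they are
      \<open>2 (v - a)\<close> and \<open>2 (u - a)\<close>.\<close>
    define c where "c = (v - v ^ q) / (u - u ^ q)"
    have "c ^ q = (v ^ q - v) / (u ^ q - u)" by (simp add: c_def power_divide diff qq)
    also have "\<dots> = c" unfolding c_def by (metis minus_diff_eq minus_divide_divide)
    finally have c_Fq: "c \<in> Fq" by (simp add: fixed)
    have c0: "c \<noteq> 0" using vq uq by (simp add: c_def)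
    have v_eq: "v = a + (u - a) * c"
    proof -
      have "(u - u ^ q) * c = v - v ^ q" using uq by (simp add: c_def)
      then have 1: "(u - a) * c = (v - v ^ q) / 2" unfolding ua by (simp only: times_divide_eq_left)
      have 2: "a = (v + v ^ q) / 2" using common(1) by (simp add: a_def)
      have "v = (v + v ^ q) / 2 + (v - v ^ q) / 2" using two by (simp add: field_simps)
      also have "\<dots> = a + (u - a) * c" by (rule arg_cong2[OF 2[symmetric] 1[symmetric]])
      finally show ?thesis .
    qed
    have Fq_unit: "x ^ (q - 1) = 1" if "x \<in> Fq" "x \<noteq> 0" for x
    proof -
      have "x * x ^ (q - 1) = x * 1" using that fixed q3 by (cases q) auto
      then show ?thesis using that(2) by simp
    qed
    \<comment> \<open>The parity of \<open>k\<close> is drawn from the adjacency of \<open>u\<close>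
      and \<open>v\<close>, hence the separate case \<open>v = u\<close>, where
      \<open>c = 1\<close>.\<close>
    have "c ^ (k - 2) = 1"
    proof (cases "v = u")
      case True
      then show ?thesis using uq by (simp add: c_def)
    next
      case False
      txt \<open>The difference \<open>v - u\<close> is a multiple in \<open>Fq\<close> of \<open>u - a\<close>, so adjacency makes \<open>u - a\<close> an
        \<open>m\<close>-th power; since \<open>(u - a) ^ (q - 1) = -1\<close>, this forces \<open>k\<close> to be even.\<close>
      let ?w = "u - a"
      have vu: "v - u = (c - 1) * ?w" by (simp add: v_eq algebra_simps)
      have "c - 1 \<in> Fq" unfolding fixed using c_Fq fixed by (simp add: diff)
      moreover have "c - 1 \<noteq> 0" using False vu by auto
      ultimately have "(c - 1) ^ (q - 1) = 1" by (rule Fq_unit)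
      then have "(c - 1) ^ M = 1" by (simp add: M_def power_mult)
      moreover have "(v - u) ^ M = 1" using adj[OF v(1) _ False] assms(14) by auto
      ultimately have wM: "?w ^ M = 1" unfolding vu by (simp add: power_mult_distrib)
      have w0: "?w \<noteq> 0" using a_Fq assms(12) by auto
      have "?w ^ q = - ?w" unfolding ua by (simp add: power_divide diff qq two_q minus_divide_left)
      moreover have "?w ^ q = ?w * ?w ^ (q - 1)" using q3 by (cases q) auto
      ultimately have "?w * ?w ^ (q - 1) = ?w * (- 1)" by simp
      then have "?w ^ (q - 1) = - 1" using w0 mult_left_cancel by blast
      then have "(- 1 :: 'a) ^ k = 1" using wM by (simp add: M_def power_mult)
      then have "even k" using two by (cases "even k") (auto simp: eq_neg_iff_add_eq_0)
      then show ?thesis using common(2) by (simp add: c_def)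
    qed
    then have "c ^ d = 1"
      unfolding d_def using Fq_unit[OF c_Fq c0] by (intro power_gcd_eq_1)
    then show ?thesis using c_Fq v_eq by (auto simp: B_def H_def)
  qed

  \<comment> \<open>Covering of the clique and the numerical bounds\<close>
  have Fq_part: "v \<in> GP_nbrs Fq m u" if "v \<in> C'" "v \<in> Fq" for v
    using adj[of u v] that assms(12,14) by (auto simp: N_eq)
  have cover: "C' \<subseteq> GP_nbrs Fq m u \<union> B" using main Fq_part by blast
  \<comment> \<open>Reduces both the unique existence and the quantification over subgroups of order
    \<open>d\<close> to the explicit set \<open>H\<close>.\<close>
  have subgroup_iff: "is_mult_subgroup L Fq \<and> card L = d \<longleftrightarrow> L = H" for L
    unfolding H_def using K by (intro mult_subgroup_card_iff) (auto simp: d_def)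
  then have cH: "card H = d" by blast
  have "B = (\<lambda>h. a + (u - a) * h) ` H" by (auto simp: B_def)
  then have "card B \<le> d" using card_image_le[of H] cH by simp
  moreover have "card C' \<le> card (GP_nbrs Fq m u) + card B"
    using card_mono[OF _ cover] card_Un_le[of "GP_nbrs Fq m u" B] by simp
  ultimately have "card C' \<le> (k - 1) + d" using cN by simp
  moreover have k_real: "(real q + 1) / real m = real k"
    using arg_cong[OF mk, of real] assms(9) by (simp add: field_simps)
  ultimately have card_bound: "real (card C') \<le> (real q + 1) / real m - 1 + real d"
    using k3 by simp
  \<comment> \<open>After cancelling (q + 1) / m, the second inequality says that d + 2 is at most
    the square root.\<close>
  have "(real d + 2)\<^sup>2 \<le> 2 * (real q + 1)"
    using of_nat_mono[OF gcd_quotient_bound[OF mk assms(9) k3], where ?'a = real]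
    by (simp add: d_def add.commute)
  then have "real d + 2 \<le> sqrt (2 * (real q + 1))" by (intro real_le_rsqrt)
  moreover have "C' \<subseteq> Fq \<union> line Fq a (u - a)"
    using cover by (fastforce simp: B_def H_def line_def GP_nbrs_def mult.commute)
  ultimately show ?thesis
    unfolding k_def[symmetric] d_def[symmetric] subgroup_iff
    using card_bound cover a_Fq by (intro conjI bexI[of _ a]) (auto simp: B_def)
qed

end
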